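(* Let $R$ be a ring which is complete with respect to a two-sided ideal $I$ (such an ideal is necessarily contained in the Jacobson radical $J(R)$). Let $x \in R$ and let $n$ be a positive integer. If the image of $x$ in $R/I$ is strongly $\pi$-regular of degree $n$ in $R/I$, then $x$ is strongly $\pi$-clean of degree $n$ with respect to $I$. In particular, $x$ is strongly clean in $R$.
   Context: All rings are associative (not necessarily commutative) with unity $1$, which is preserved by ring homomorphisms. $R$ is complete with respect to $I$ (i.e. $I$-adically complete) in the usual sense: the natural map $R \to \varprojlim_{i\ge 1} R/I^i$ is an isomorphism (in particular $\bigcap_{i\ge 1} I^i = 0$). Let $S$ be a ring, $y\in S$, and $e \in S$ an idempotent. The element $y$ is $e$-strongly clean if $ey = ye$ and $y - e$ is a unit of $S$. The element $y$ is strongly clean if it is $e$-strongly clean for some idempotent $e \in S$. Let $K$ be a two-sided ideal of $S$. The element $y \in S$ is $e$-strongly $\pi$-clean of degree $n$ with respect to $K$ if $y$ is $e$-strongly clean and, in addition, the image of $eye$ in $S/K$ is nilpotent of degree $n$, meaning $(eye)^n \in K$. The element $y$ is strongly $\pi$-clean of degree $n$ with respect to $K$ if there exists an idempotent $e \in S$ such that $y$ is $e$-strongly $\pi$-clean of degree $n$ with respect to $K$. The element $y \in S$ is strongly $\pi$-regular of degree $n$ if it is strongly $\pi$-clean of degree $n$ with respect to the zero ideal of $S$; that is, there is an idempotent $e\in S$ with $ey = ye$, $y - e$ a unit of $S$, and $(eye)^n = 0$. *)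

theory Defs
  imports "HOL-Algebra.Algebra"
begin

section \<open>Strongly clean elements\<close>

definition e_strongly_clean :: "('a, 'b) ring_scheme \<Rightarrow> 'a \<Rightarrow> 'a \<Rightarrow> bool" where
  "e_strongly_clean S e y \<longleftrightarrow>
     e \<in> carrier S \<and> y \<in> carrier S \<and> e \<otimes>\<^bsub>S\<^esub> e = e \<and>
     e \<otimes>\<^bsub>S\<^esub> y = y \<otimes>\<^bsub>S\<^esub> e \<and> y \<ominus>\<^bsub>S\<^esub> e \<in> Units S"

definition strongly_clean :: "('a, 'b) ring_scheme \<Rightarrow> 'a \<Rightarrow> bool" where
  "strongly_clean S y \<longleftrightarrow> (\<exists>e. e_strongly_clean S e y)"

definition e_strongly_pi_clean ::
    "('a, 'b) ring_scheme \<Rightarrow> 'a set \<Rightarrow> 'a \<Rightarrow> 'a \<Rightarrow> nat \<Rightarrow> bool" where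
  "e_strongly_pi_clean S K e y n \<longleftrightarrow>
     e_strongly_clean S e y \<and> (e \<otimes>\<^bsub>S\<^esub> y \<otimes>\<^bsub>S\<^esub> e) [^]\<^bsub>S\<^esub> n \<in> K"

definition strongly_pi_clean ::
    "('a, 'b) ring_scheme \<Rightarrow> 'a set \<Rightarrow> 'a \<Rightarrow> nat \<Rightarrow> bool" where
  "strongly_pi_clean S K y n \<longleftrightarrow> (\<exists>e. e_strongly_pi_clean S K e y n)"

definition strongly_pi_regular :: "('a, 'b) ring_scheme \<Rightarrow> 'a \<Rightarrow> nat \<Rightarrow> bool" where
  "strongly_pi_regular S y n \<longleftrightarrow> strongly_pi_clean S {\<zero>\<^bsub>S\<^esub>} y n"


section \<open>Adic completeness\<close>

abbreviation ideal_pow :: "('a, 'b) ring_scheme \<Rightarrow> 'a set \<Rightarrow> nat \<Rightarrow> 'a set" where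
  "ideal_pow R I i \<equiv> I [^]\<^bsub>ideals_set R\<^esub> i"

text \<open>For \<open>J \<subseteq> K\<close>, the projection from \<open>R/J\<close> to \<open>R/K\<close>: it sends \<open>J + r\<close> to
  \<open>K + (J + r) = K + r\<close>.\<close>

definition quot_proj :: "('a, 'b) ring_scheme \<Rightarrow> 'a set \<Rightarrow> 'a set \<Rightarrow> 'a set" where
  "quot_proj R K C = K <+>\<^bsub>R\<^esub> C"

text \<open>The inverse limit of the rings \<open>R/I^i\<close> over \<open>i \<ge> 1\<close>, as a subring of their product.\<close>

definition adic_limit :: "('a, 'b) ring_scheme \<Rightarrow> 'a set \<Rightarrow> (nat \<Rightarrow> 'a set) ring" where
  "adic_limit R I =
     \<lparr>carrier = {f \<in> (\<Pi>\<^sub>E i\<in>{1..}. carrier (R Quot ideal_pow R I i)).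
                   \<forall>i\<ge>1. \<forall>j\<ge>i. quot_proj R (ideal_pow R I i) (f j) = f i},
      monoid.mult = (\<lambda>f g. \<lambda>i\<in>{1..}. f i \<otimes>\<^bsub>R Quot ideal_pow R I i\<^esub> g i),
      monoid.one = (\<lambda>i\<in>{1..}. \<one>\<^bsub>R Quot ideal_pow R I i\<^esub>),
      ring.zero = (\<lambda>i\<in>{1..}. \<zero>\<^bsub>R Quot ideal_pow R I i\<^esub>),
      ring.add = (\<lambda>f g. \<lambda>i\<in>{1..}. f i \<oplus>\<^bsub>R Quot ideal_pow R I i\<^esub> g i)\<rparr>"

definition adic_map :: "('a, 'b) ring_scheme \<Rightarrow> 'a set \<Rightarrow> 'a \<Rightarrow> nat \<Rightarrow> 'a set" where
  "adic_map R I r = (\<lambda>i\<in>{1..}. ideal_pow R I i +>\<^bsub>R\<^esub> r)"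

definition adically_complete :: "('a, 'b) ring_scheme \<Rightarrow> 'a set \<Rightarrow> bool" where
  "adically_complete R I \<longleftrightarrow> adic_map R I \<in> ring_iso R (adic_limit R I)"


section \<open>The Jacobson radical of a not necessarily commutative ring\<close>

definition left_ideal :: "('a, 'b) ring_scheme \<Rightarrow> 'a set \<Rightarrow> bool" where
  "left_ideal R L \<longleftrightarrow>
     additive_subgroup L R \<and> (\<forall>r\<in>carrier R. \<forall>a\<in>L. r \<otimes>\<^bsub>R\<^esub> a \<in> L)"

definition maximal_left_ideal :: "('a, 'b) ring_scheme \<Rightarrow> 'a set \<Rightarrow> bool" where
  "maximal_left_ideal R M \<longleftrightarrow>
     left_ideal R M \<and> M \<noteq> carrier R \<and>
     (\<forall>L. left_ideal R L \<longrightarrow> M \<subseteq> L \<longrightarrow> L = M \<or> L = carrier R)"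

text \<open>Intersecting with the carrier makes the radical of the zero ring, which has no maximal
  left ideals, the whole ring.\<close>

definition jacobson_radical :: "('a, 'b) ring_scheme \<Rightarrow> 'a set" where
  "jacobson_radical R = carrier R \<inter> \<Inter>{M. maximal_left_ideal R M}"

end

theory Submission
  imports Defs
begin

text \<open>Idea. It suffices to build elements \<open>e\<^sub>k\<close>, congruent to each other modulo growing powers of \<open>I\<close>,
  which modulo \<open>I^k\<close> are idempotent and commute with \<open>x\<close>; their limit is the required idempotent, and
  \<open>x - e\<close> is a unit because it is one modulo \<open>I\<close> and \<open>1 + I\<close> consists of units (geometric series).
  To pass from \<open>k\<close> to \<open>k + 1\<close> work in \<open>R/I^(k+1)\<close>, where \<open>J = I^k/I^(k+1)\<close> is an \<open>R/I\<close>-bimodule of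
  square zero. First make \<open>e\<close> idempotent; with \<open>f = 1 - e\<close>, the obstructions to commuting with \<open>x\<close>
  are then \<open>e x f\<close> and \<open>f x e\<close> in \<open>J\<close>. Replacing \<open>e\<close> by \<open>e + a + b\<close> with \<open>a \<in> e J f\<close>, \<open>b \<in> f J e\<close>
  removes them as soon as \<open>x a - a x = e x f\<close> and \<open>b x - x b = f x e\<close>. These Sylvester equations are
  solvable since \<open>x\<close> is nilpotent on the \<open>e\<close>-side and invertible on the \<open>f\<close>-side.\<close>

section \<open>Lifting across a square-zero ideal\<close>

text \<open>On \<open>J\<close>, the element \<open>w\<close> acts as an inverse of \<open>x - e\<close>. The solution obtained by the recursion
  is \<open>a = - (\<Sum>i<m. x^i t w^(i+1))\<close>.\<close>

lemma (in ring) sylvester_corner_left: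
  assumes "ideal J R" and x: "x \<in> carrier R" and w: "w \<in> carrier R" and e: "e \<in> carrier R"
    and ex: "\<And>j. j \<in> J \<Longrightarrow> e \<otimes> (x \<otimes> j) = x \<otimes> (e \<otimes> j)"
    and we: "\<And>j. j \<in> J \<Longrightarrow> j \<otimes> w \<otimes> e = j \<otimes> e \<otimes> w"
    and wx: "\<And>j. j \<in> J \<Longrightarrow> j \<otimes> w \<otimes> x = j \<otimes> w \<otimes> e \<oplus> j"
    and "t \<in> J" "e \<otimes> t = t" "t \<otimes> e = \<zero>"
  shows "\<exists>a\<in>J. e \<otimes> a = a \<and> a \<otimes> e = \<zero> \<and>
    x \<otimes> a \<ominus> a \<otimes> x = t \<ominus> x [^] (m::nat) \<otimes> t \<otimes> w [^] m"
  using assms(8-10)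
proof (induction m arbitrary: t)
  case 0
  interpret J: ideal J R by fact
  have "t \<in> carrier R" using 0 by simp
  then show ?case
    using x e by (intro bexI[of _ \<zero>]) (auto simp: J.zero_closed minus_eq r_neg)
next
  case (Suc m)
  interpret J: ideal J R by fact
  have t: "t \<in> carrier R" using Suc.prems by simp
  \<comment> \<open>As \<open>t w x = t\<close>, the element \<open>- t w\<close> solves the
    equation up to the error \<open>u\<close>: the map \<open>a -> x a - a x\<close> sends it to
    \<open>t - u\<close>. The induction hypothesis deals with \<open>u\<close>, hence the witness
    \<open>a - t w\<close>.\<close>
  define u where "u = x \<otimes> t \<otimes> w"
  have u: "u \<in> J" "u \<in> carrier R"
    using Suc.prems t x w by (auto simp: u_def J.I_l_closed J.I_r_closed)
  have twe: "t \<otimes> w \<otimes> e = \<zero>" using we Suc.prems w by simp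
  have "e \<otimes> u = u"
    using ex[OF \<open>t \<in> J\<close>] Suc.prems t x w e by (simp add: u_def m_assoc[symmetric])
  moreover have "u \<otimes> e = \<zero>"
    using twe t x w e by (simp add: u_def m_assoc)
  ultimately obtain a where a: "a \<in> J" "e \<otimes> a = a" "a \<otimes> e = \<zero>"
    "x \<otimes> a \<ominus> a \<otimes> x = u \<ominus> x [^] m \<otimes> u \<otimes> w [^] m"
    using Suc.IH u by blast
  have ac: "a \<in> carrier R" using a by simp
  have "t \<otimes> w \<otimes> x = t" using wx[OF \<open>t \<in> J\<close>] twe t by simp
  moreover have "x \<otimes> (a \<ominus> t \<otimes> w) \<ominus> (a \<ominus> t \<otimes> w) \<otimes> x
      = (x \<otimes> a \<ominus> a \<otimes> x) \<ominus> u \<oplus> t \<otimes> w \<otimes> x"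
    using t x w ac unfolding u_def by algebra
  moreover have "x [^] Suc m \<otimes> t \<otimes> w [^] Suc m = x [^] m \<otimes> u \<otimes> w [^] m"
    unfolding u_def nat_pow_Suc2[OF w] using t x w by (simp add: m_assoc)
  moreover have "x [^] m \<otimes> u \<otimes> w [^] m \<in> carrier R" using u x w by simp
  ultimately have "x \<otimes> (a \<ominus> t \<otimes> w) \<ominus> (a \<ominus> t \<otimes> w) \<otimes> x
      = t \<ominus> x [^] Suc m \<otimes> t \<otimes> w [^] Suc m"
    using a(4) u(2) t by (simp only:) algebra
  moreover have "a \<ominus> t \<otimes> w \<in> J"
    using a(1) Suc.prems w unfolding minus_eq by (simp add: J.I_r_closed)
  moreover have "e \<otimes> (a \<ominus> t \<otimes> w) = e \<otimes> a \<ominus> e \<otimes> t \<otimes> w"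
    using e ac t w by algebra
  moreover have "(a \<ominus> t \<otimes> w) \<otimes> e = a \<otimes> e \<ominus> t \<otimes> w \<otimes> e"
    using e ac t w by algebra
  ultimately show ?case using a(2,3) Suc.prems(2) twe by (intro bexI[of _ "a \<ominus> t \<otimes> w"]) (auto simp: minus_eq)
qed

text \<open>Mirror image of \<open>sylvester_corner_left\<close>, by the same argument in the
  opposite ring. The solution is minus the sum of \<open>w^(i+1) s x^i\<close> over
  \<open>i < m\<close>.\<close>

lemma (in ring) sylvester_corner_right:
  assumes "ideal J R" and x: "x \<in> carrier R" and w: "w \<in> carrier R" and e: "e \<in> carrier R"
    and ex: "\<And>j. j \<in> J \<Longrightarrow> j \<otimes> x \<otimes> e = j \<otimes> e \<otimes> x"
    and we: "\<And>j. j \<in> J \<Longrightarrow> e \<otimes> (w \<otimes> j) = w \<otimes> (e \<otimes> j)"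
    and wx: "\<And>j. j \<in> J \<Longrightarrow> x \<otimes> (w \<otimes> j) = e \<otimes> (w \<otimes> j) \<oplus> j"
    and "s \<in> J" "e \<otimes> s = \<zero>" "s \<otimes> e = s"
  shows "\<exists>b\<in>J. e \<otimes> b = \<zero> \<and> b \<otimes> e = b \<and>
    b \<otimes> x \<ominus> x \<otimes> b = s \<ominus> w [^] (m::nat) \<otimes> s \<otimes> x [^] m"
  using assms(8-10)
proof (induction m arbitrary: s)
  case 0
  interpret J: ideal J R by fact
  have "s \<in> carrier R" using 0 by simp
  then show ?case
    using x e by (intro bexI[of _ \<zero>]) (auto simp: J.zero_closed minus_eq r_neg)
next
  case (Suc m)
  interpret J: ideal J R by fact
  have s: "s \<in> carrier R" using Suc.prems by simp
  define u where "u = w \<otimes> s \<otimes> x"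
  have u: "u \<in> J" "u \<in> carrier R"
    using Suc.prems s x w by (auto simp: u_def J.I_l_closed J.I_r_closed)
  have ews: "e \<otimes> (w \<otimes> s) = \<zero>" using we Suc.prems w by simp
  have "u \<otimes> e = u"
    using ex[OF \<open>s \<in> J\<close>] Suc.prems s x w e by (simp add: u_def m_assoc)
  moreover have "e \<otimes> u = \<zero>"
    using ews s x w e by (simp add: u_def m_assoc[symmetric])
  ultimately obtain b where b: "b \<in> J" "e \<otimes> b = \<zero>" "b \<otimes> e = b"
    "b \<otimes> x \<ominus> x \<otimes> b = u \<ominus> w [^] m \<otimes> u \<otimes> x [^] m"
    using Suc.IH u by blast
  have bc: "b \<in> carrier R" using b by simp
  have "x \<otimes> (w \<otimes> s) = s" using wx[OF \<open>s \<in> J\<close>] ews s by simp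
  moreover have "(b \<ominus> w \<otimes> s) \<otimes> x \<ominus> x \<otimes> (b \<ominus> w \<otimes> s)
      = (b \<otimes> x \<ominus> x \<otimes> b) \<ominus> u \<oplus> x \<otimes> (w \<otimes> s)"
    using s x w bc unfolding u_def by algebra
  moreover have "w [^] Suc m \<otimes> s \<otimes> x [^] Suc m = w [^] m \<otimes> u \<otimes> x [^] m"
    unfolding u_def nat_pow_Suc2[OF x] using s x w by (simp add: m_assoc)
  moreover have "w [^] m \<otimes> u \<otimes> x [^] m \<in> carrier R" using u x w by simp
  ultimately have "(b \<ominus> w \<otimes> s) \<otimes> x \<ominus> x \<otimes> (b \<ominus> w \<otimes> s)
      = s \<ominus> w [^] Suc m \<otimes> s \<otimes> x [^] Suc m"
    using b(4) u(2) s by (simp only:) algebra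
  moreover have "b \<ominus> w \<otimes> s \<in> J"
    using b(1) Suc.prems w unfolding minus_eq by (simp add: J.I_l_closed)
  moreover have "e \<otimes> (b \<ominus> w \<otimes> s) = e \<otimes> b \<ominus> e \<otimes> (w \<otimes> s)"
    using e bc s w by algebra
  moreover have "(b \<ominus> w \<otimes> s) \<otimes> e = b \<otimes> e \<ominus> w \<otimes> (s \<otimes> e)"
    using e bc s w by algebra
  ultimately show ?case using b(2,3) Suc.prems(3) ews by (intro bexI[of _ "b \<ominus> w \<otimes> s"]) (auto simp: minus_eq)
qed

text \<open>Nilpotency is given for \<open>e x e\<close>, but the remainders in the Sylvester lemmas
  contain powers of \<open>x\<close>. The two act alike on a \<open>t\<close> in \<open>J\<close>
  fixed by \<open>e\<close>, and \<open>x t\<close> is again fixed by \<open>e\<close>, so the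
  argument iterates.\<close>

lemma (in ring) corner_pow_l:
  assumes "ideal J R" and x: "x \<in> carrier R" and e: "e \<in> carrier R"
    and ex: "\<And>j. j \<in> J \<Longrightarrow> e \<otimes> (x \<otimes> j) = x \<otimes> (e \<otimes> j)"
    and "t \<in> J" "e \<otimes> t = t"
  shows "(e \<otimes> x \<otimes> e) [^] (m::nat) \<otimes> t = x [^] m \<otimes> t"
  using assms(5,6)
proof (induction m arbitrary: t)
  case 0
  then show ?case by simp
next
  case (Suc m)
  interpret J: ideal J R by fact
  have t: "t \<in> carrier R" using Suc.prems by simp
  have "e \<otimes> (x \<otimes> t) = x \<otimes> t" using ex Suc.prems by simp
  then have "(e \<otimes> x \<otimes> e) [^] m \<otimes> (x \<otimes> t) = x [^] m \<otimes> (x \<otimes> t)"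
    using Suc.IH[of "x \<otimes> t"] Suc.prems x by (simp add: J.I_l_closed)
  with \<open>e \<otimes> (x \<otimes> t) = x \<otimes> t\<close> show ?case using x e t Suc.prems by (simp add: m_assoc)
qed

lemma (in ring) corner_pow_r:
  assumes "ideal J R" and x: "x \<in> carrier R" and e: "e \<in> carrier R"
    and ex: "\<And>j. j \<in> J \<Longrightarrow> j \<otimes> x \<otimes> e = j \<otimes> e \<otimes> x"
    and "s \<in> J" "s \<otimes> e = s"
  shows "s \<otimes> (e \<otimes> x \<otimes> e) [^] (m::nat) = s \<otimes> x [^] m"
  using assms(5,6)
proof (induction m arbitrary: s)
  case 0
  then show ?case by simp
next
  case (Suc m)
  interpret J: ideal J R by fact
  have s: "s \<in> carrier R" using Suc.prems by simp
  have sxe: "s \<otimes> x \<otimes> e = s \<otimes> x" using ex Suc.prems by simp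
  then have "s \<otimes> x \<otimes> (e \<otimes> x \<otimes> e) [^] m = s \<otimes> x \<otimes> x [^] m"
    using Suc.IH[of "s \<otimes> x"] Suc.prems x by (simp add: J.I_r_closed)
  moreover have "s \<otimes> (e \<otimes> x \<otimes> e) = s \<otimes> x"
    using sxe Suc.prems s x e by (simp add: m_assoc[symmetric])
  ultimately show ?case
    using x e s nat_pow_Suc2[of x m] nat_pow_Suc2[of "e \<otimes> x \<otimes> e" m]
    by (metis m_assoc m_closed nat_pow_closed)
qed

text \<open>Here \<open>p = 3e^2 - 2e^3\<close>, the Newton step for the equation \<open>e^2 = e\<close>.\<close>

lemma (in ring) approx_idempotent:
  assumes e: "e \<in> carrier R" and d: "d = e \<otimes> e \<ominus> e" and dd: "d \<otimes> d = \<zero>"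
    and p: "p = e \<oplus> d \<ominus> (e \<otimes> d \<oplus> e \<otimes> d)"
  shows "p \<otimes> p = p"
proof -
  have dc: "d \<in> carrier R" using d e by simp
  \<comment> \<open>The facts below form the multiplication table of \<open>e\<close>,
    \<open>d\<close> and \<open>g = e d\<close>: every product of two of them is a sum of these
    elements or zero. This makes \<open>p p\<close> a linear computation.\<close>
  define g where "g = e \<otimes> d"
  have gc: "g \<in> carrier R" using dc e by (simp add: g_def)
  have ee: "e \<otimes> e = e \<oplus> d" using e unfolding d by algebra
  have de: "d \<otimes> e = g" using e unfolding d g_def by algebra
  have eg: "e \<otimes> g = g"
    using e dc dd by (simp add: g_def m_assoc[symmetric] ee l_distr)
  have ge: "g \<otimes> e = g"
    using e dc de eg by (simp add: g_def m_assoc)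
  have gd: "g \<otimes> d = \<zero>" using e dc dd by (simp add: g_def m_assoc)
  have dg: "d \<otimes> g = \<zero>" using e dc dd by (simp flip: de add: m_assoc[symmetric])
  have gg: "g \<otimes> g = \<zero>" using e dc gc ge gd m_assoc[of g e d] by (simp flip: g_def)
  have p': "p = e \<oplus> d \<ominus> (g \<oplus> g)" using p by (simp add: g_def)
  have pc: "p \<in> carrier R" using e dc gc by (simp add: p')
  have pr: "p \<otimes> y = e \<otimes> y \<oplus> d \<otimes> y \<ominus> (g \<otimes> y \<oplus> g \<otimes> y)" if "y \<in> carrier R" for y
    using e dc gc that unfolding p' by algebra
  have "p \<otimes> p = p \<otimes> (e \<oplus> d \<ominus> (g \<oplus> g))" by (simp only: p')
  also have "\<dots> = p \<otimes> e \<oplus> p \<otimes> d \<ominus> (p \<otimes> g \<oplus> p \<otimes> g)"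
    using e dc gc pc by algebra
  also have "\<dots> = e \<oplus> d \<oplus> g \<ominus> (g \<oplus> g) \<oplus> (g \<oplus> \<zero> \<ominus> (\<zero> \<oplus> \<zero>))
      \<ominus> (g \<oplus> \<zero> \<ominus> (\<zero> \<oplus> \<zero>) \<oplus> (g \<oplus> \<zero> \<ominus> (\<zero> \<oplus> \<zero>)))"
    unfolding pr[OF e] pr[OF dc] pr[OF gc] by (simp only: ee de dd eg ge gd dg gg flip: g_def)
  also have "\<dots> = p" using e dc gc unfolding p' by algebra
  finally show ?thesis .
qed

text \<open>The conditions on \<open>w\<close> and the nilpotency are only required modulo
  \<open>I\<close>: as \<open>I\<close> annihilates \<open>J\<close> on both sides, congruences
  modulo \<open>I\<close> become equations once they act on \<open>J\<close>, and the corrections to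
  \<open>e\<close> all lie in \<open>J\<close>.\<close>

lemma (in ring) lift_commuting_idempotent:
  assumes "ideal J R" "ideal I R" "J \<subseteq> I"
    and IJ: "\<And>i j. i \<in> I \<Longrightarrow> j \<in> J \<Longrightarrow> i \<otimes> j = \<zero>" and JI: "\<And>i j. i \<in> I \<Longrightarrow> j \<in> J \<Longrightarrow> j \<otimes> i = \<zero>"
    and x: "x \<in> carrier R" and w: "w \<in> carrier R" and e: "e \<in> carrier R"
    and idem: "e \<otimes> e \<ominus> e \<in> J" and comm: "x \<otimes> e \<ominus> e \<otimes> x \<in> J"
    and we: "w \<otimes> e \<ominus> e \<otimes> w \<in> I"
    and wx: "w \<otimes> (x \<ominus> e) \<ominus> \<one> \<in> I" and xw: "(x \<ominus> e) \<otimes> w \<ominus> \<one> \<in> I"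
    and nil: "(e \<otimes> x \<otimes> e) [^] (n::nat) \<in> I"
  shows "\<exists>e'\<in>carrier R. e' \<ominus> e \<in> J \<and> e' \<otimes> e' = e' \<and> x \<otimes> e' = e' \<otimes> x"
proof -
  interpret J: ideal J R by fact
  interpret I: ideal I R by fact
  \<comment> \<open>\<open>J\<close> is a bimodule over \<open>R/I\<close>: elements congruent
    modulo \<open>I\<close> act on it identically.\<close>
  have act_l: "u \<otimes> j = v \<otimes> j" and act_r: "j \<otimes> u = j \<otimes> v"
    if "u \<ominus> v \<in> I" "j \<in> J" "u \<in> carrier R" "v \<in> carrier R" for u v j
  proof -
    have jc: "j \<in> carrier R" using that by simp
    have "u \<otimes> j = (u \<ominus> v) \<otimes> j \<oplus> v \<otimes> j" using that jc by algebra
    then show "u \<otimes> j = v \<otimes> j" using IJ that jc by simp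
    have "j \<otimes> u = j \<otimes> (u \<ominus> v) \<oplus> j \<otimes> v" using that jc by algebra
    then show "j \<otimes> u = j \<otimes> v" using JI that jc by simp
  qed
  define d where "d = e \<otimes> e \<ominus> e"
  define p where "p = e \<oplus> d \<ominus> (e \<otimes> d \<oplus> e \<otimes> d)"
  have dJ: "d \<in> J" using idem by (simp add: d_def)
  then have dc: "d \<in> carrier R" by simp
  have pc: "p \<in> carrier R" using e dc by (simp add: p_def)
  have pp: "p \<otimes> p = p"
    using approx_idempotent[OF e d_def _ p_def] IJ dJ \<open>J \<subseteq> I\<close> by blast
  \<comment> \<open>The Newton correction. It lies in \<open>J\<close>, hence in \<open>I\<close>,
    so \<open>p\<close> and \<open>e\<close> act alike on \<open>J\<close>.\<close>
  define q where "q = d \<ominus> (e \<otimes> d \<oplus> e \<otimes> d)"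
  have qJ: "q \<in> J" using dJ e unfolding q_def minus_eq by (simp add: J.I_l_closed)
  then have qc: "q \<in> carrier R" by simp
  have pq: "p = e \<oplus> q" using e dc unfolding p_def q_def by algebra
  have "p \<ominus> e = q" using e qc unfolding pq by algebra
  with qJ \<open>J \<subseteq> I\<close> have peI: "p \<ominus> e \<in> I" by auto
  have "x \<otimes> p \<ominus> p \<otimes> x = (x \<otimes> e \<ominus> e \<otimes> x) \<oplus> x \<otimes> q \<oplus> \<ominus> (q \<otimes> x)"
    using x e qc unfolding pq by algebra
  then have xp: "x \<otimes> p \<ominus> p \<otimes> x \<in> J"
    using comm qJ x by (simp add: J.I_l_closed J.I_r_closed)
  have pl: "p \<otimes> j = e \<otimes> j" and pr: "j \<otimes> p = j \<otimes> e" if "j \<in> J" for j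
    using act_l[OF peI that pc e] act_r[OF peI that pc e] by auto
  have ml: "y \<otimes> j \<in> J" and mr: "j \<otimes> y \<in> J" if "j \<in> J" "y \<in> carrier R" for j y
    using that by (auto simp: J.I_l_closed J.I_r_closed)
  have J_carr [simp]: "j \<in> carrier R" if "j \<in> J" for j using that by simp
  have xpI: "x \<otimes> p \<ominus> p \<otimes> x \<in> I" using xp \<open>J \<subseteq> I\<close> by auto
  \<comment> \<open>From here to \<open>wx_l\<close>: the hypotheses of the Sylvester lemmas with
    the idempotent \<open>p\<close> in the role of \<open>e\<close>.\<close>
  have xp_l: "p \<otimes> (x \<otimes> j) = x \<otimes> (p \<otimes> j)" and xp_r: "j \<otimes> x \<otimes> p = j \<otimes> p \<otimes> x" if "j \<in> J" for j
    using act_l[OF xpI that] act_r[OF xpI that] x pc that by (auto simp: m_assoc)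
  have wp_l: "p \<otimes> (w \<otimes> j) = w \<otimes> (p \<otimes> j)" and wp_r: "j \<otimes> w \<otimes> p = j \<otimes> p \<otimes> w" if "j \<in> J" for j
    using act_l[OF we that] act_r[OF we that] w e that pl pr ml mr by (auto simp: m_assoc)
  have wx_r: "j \<otimes> w \<otimes> x = j \<otimes> w \<otimes> p \<oplus> j" if "j \<in> J" for j
  proof -
    have "j \<otimes> (w \<otimes> (x \<ominus> e)) = j" using act_r[OF wx that] w x e that by simp
    moreover have "j \<otimes> w \<otimes> x = j \<otimes> (w \<otimes> (x \<ominus> e)) \<oplus> j \<otimes> w \<otimes> e"
      using J_carr[OF that] w x e by algebra
    ultimately show ?thesis using that w e pr mr by (simp add: a_comm)
  qed
  have wx_l: "x \<otimes> (w \<otimes> j) = p \<otimes> (w \<otimes> j) \<oplus> j" if "j \<in> J" for j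
  proof -
    have "(x \<ominus> e) \<otimes> w \<otimes> j = j" using act_l[OF xw that] w x e that by simp
    moreover have "x \<otimes> (w \<otimes> j) = (x \<ominus> e) \<otimes> w \<otimes> j \<oplus> e \<otimes> (w \<otimes> j)"
      using J_carr[OF that] w x e by algebra
    ultimately show ?thesis using that w e pl ml by (simp add: a_comm)
  qed
  have ex_l: "e \<otimes> (x \<otimes> j) = x \<otimes> (e \<otimes> j)" and ex_r: "j \<otimes> x \<otimes> e = j \<otimes> e \<otimes> x" if "j \<in> J" for j
    using xp_l xp_r pl pr that ml mr x by auto
  \<comment> \<open>These two facts kill the remainders \<open>x^n t w^n\<close> and
    \<open>w^n s x^n\<close>. An element of \<open>J\<close> fixed by \<open>p\<close> is also fixed
    by \<open>e\<close>, so \<open>x^n\<close> acts on it as \<open>(e x e)^n\<close>, which lies in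
    \<open>I\<close>.\<close>
  have nil_l: "x [^] n \<otimes> j = \<zero>" if "j \<in> J" "p \<otimes> j = j" for j
    using corner_pow_l[OF \<open>ideal J R\<close> x e, of j n] ex_l that pl IJ[OF nil] by simp
  have nil_r: "j \<otimes> x [^] n = \<zero>" if "j \<in> J" "j \<otimes> p = j" for j
    using corner_pow_r[OF \<open>ideal J R\<close> x e, of j n] ex_r that pr JI[OF nil] by simp

  \<comment> \<open>The off-diagonal Peirce components of \<open>x\<close>:
    \<open>t = p x (1 - p)\<close> and \<open>s = (1 - p) x p\<close>. Their difference
    \<open>s - t\<close> is the commutator \<open>x p - p x\<close>, so both lie in
    \<open>J\<close>.\<close>
  define t where "t = p \<otimes> x \<ominus> p \<otimes> x \<otimes> p"
  define s where "s = x \<otimes> p \<ominus> p \<otimes> x \<otimes> p"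
  have carr: "t \<in> carrier R" "s \<in> carrier R" using x pc by (auto simp: s_def t_def)
  have "p \<otimes> (x \<otimes> p \<ominus> p \<otimes> x) = p \<otimes> x \<otimes> p \<ominus> p \<otimes> p \<otimes> x" using x pc by algebra
  then have "\<ominus> (p \<otimes> (x \<otimes> p \<ominus> p \<otimes> x)) = t" using x pc unfolding pp t_def by simp algebra
  then have tJ: "t \<in> J" using ml[OF xp pc] by (metis J.a_inv_closed)
  have "(x \<otimes> p \<ominus> p \<otimes> x) \<otimes> p = x \<otimes> (p \<otimes> p) \<ominus> p \<otimes> x \<otimes> p" using x pc by algebra
  then have sJ: "s \<in> J" using mr[OF xp pc] unfolding pp s_def by simp
  have "p \<otimes> t = p \<otimes> p \<otimes> x \<ominus> p \<otimes> p \<otimes> x \<otimes> p" using x pc unfolding t_def by algebra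
  then have pt: "p \<otimes> t = t" unfolding pp t_def .
  have "t \<otimes> p = p \<otimes> x \<otimes> p \<ominus> p \<otimes> x \<otimes> (p \<otimes> p)" using x pc unfolding t_def by algebra
  then have tp: "t \<otimes> p = \<zero>" unfolding pp using x pc by (simp add: minus_eq r_neg)
  have "p \<otimes> s = p \<otimes> x \<otimes> p \<ominus> p \<otimes> p \<otimes> x \<otimes> p" using x pc unfolding s_def by algebra
  then have ps: "p \<otimes> s = \<zero>" unfolding pp using x pc by (simp add: minus_eq r_neg)
  have "s \<otimes> p = x \<otimes> (p \<otimes> p) \<ominus> p \<otimes> x \<otimes> (p \<otimes> p)" using x pc unfolding s_def by algebra
  then have sp: "s \<otimes> p = s" unfolding pp s_def .

  obtain a where a: "a \<in> J" "p \<otimes> a = a" "a \<otimes> p = \<zero>"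
    "x \<otimes> a \<ominus> a \<otimes> x = t \<ominus> x [^] n \<otimes> t \<otimes> w [^] n"
    using sylvester_corner_left[OF \<open>ideal J R\<close> x w pc xp_l wp_r wx_r tJ pt tp] by blast
  obtain b where b: "b \<in> J" "p \<otimes> b = \<zero>" "b \<otimes> p = b"
    "b \<otimes> x \<ominus> x \<otimes> b = s \<ominus> w [^] n \<otimes> s \<otimes> x [^] n"
    using sylvester_corner_right[OF \<open>ideal J R\<close> x w pc xp_r wp_l wx_l sJ ps sp] by blast
  have ac: "a \<in> carrier R" and bc: "b \<in> carrier R" using a b by auto
  have xa: "x \<otimes> a \<ominus> a \<otimes> x = t"
    using a(4) nil_l[OF tJ pt] w carr by (simp add: minus_eq)
  have xb: "b \<otimes> x \<ominus> x \<otimes> b = s"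
    using b(4) nil_r[OF sJ sp] w x carr by (simp add: minus_eq m_assoc)
  define e' where "e' = p \<oplus> a \<oplus> b"
  have e'c: "e' \<in> carrier R" using pc ac bc by (simp add: e'_def)
  have "e' \<ominus> e = q \<oplus> a \<oplus> b" using e qc ac bc unfolding e'_def pq by algebra
  then have "e' \<ominus> e \<in> J" using a b qJ by simp
  moreover have "x \<otimes> e' = e' \<otimes> x"
  proof -
    \<comment> \<open>The three brackets are \<open>s - t\<close>, \<open>t\<close> and
      \<open>s\<close>, and so they cancel.\<close>
    have "x \<otimes> e' \<ominus> e' \<otimes> x = (x \<otimes> p \<ominus> p \<otimes> x) \<oplus> (x \<otimes> a \<ominus> a \<otimes> x) \<ominus> (b \<otimes> x \<ominus> x \<otimes> b)"
      using x pc ac bc unfolding e'_def by algebra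
    also have "\<dots> = \<zero>" unfolding xa xb s_def t_def using x pc by algebra
    finally show ?thesis using x e'c by simp
  qed
  moreover have "e' \<otimes> e' = e'"
  proof -
    \<comment> \<open>Products of \<open>a\<close> and \<open>b\<close> vanish because
      \<open>J\<close> has square zero, and \<open>p a + a p = a\<close>,
      \<open>p b + b p = b\<close> make \<open>p + a + b\<close> idempotent.\<close>
    have z: "j \<otimes> k = \<zero>" if "j \<in> J" "k \<in> J" for j k using that IJ \<open>J \<subseteq> I\<close> by auto
    have "e' \<otimes> e' = p \<otimes> p \<oplus> p \<otimes> a \<oplus> p \<otimes> b \<oplus> a \<otimes> p \<oplus> b \<otimes> p
        \<oplus> (a \<otimes> a \<oplus> a \<otimes> b \<oplus> b \<otimes> a \<oplus> b \<otimes> b)"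
      using pc ac bc unfolding e'_def by algebra
    then show ?thesis
      using pc ac bc pp a(2,3) b(2,3) z a(1) b(1) by (simp add: e'_def)
  qed
  ultimately show ?thesis using e'c by blast
qed

section \<open>Powers of an ideal\<close>

lemma ideals_set_simps [simp]:
  "\<one>\<^bsub>ideals_set R\<^esub> = carrier R"
  "A \<otimes>\<^bsub>ideals_set R\<^esub> B = ideal_prod R A B"
  by (simp_all add: ideals_set_def)

lemma ideal_pow_Suc: "ideal_pow R I (Suc i) = ideal_prod R (ideal_pow R I i) I"
  by simp

context ideal
begin

lemma ideal_pow_ideal: "ideal (ideal_pow R I i) R"
  by (induction i) (auto simp: oneideal intro!: ideal_prod_is_ideal is_ideal)

lemma ideal_pow_1: "ideal_pow R I (Suc 0) = I"
proof
  show "ideal_pow R I (Suc 0) \<subseteq> I"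
    using ideal_prod_inter[OF oneideal is_ideal] by auto
  show "I \<subseteq> ideal_pow R I (Suc 0)"
    using ideal_prod.prod[of \<one> "carrier R" _ I R] by force
qed

lemma ideal_pow_antimono: "i \<le> j \<Longrightarrow> ideal_pow R I j \<subseteq> ideal_pow R I i"
proof (induction rule: dec_induct)
  case (step j)
  then show ?case
    using ideal_prod_inter[OF ideal_pow_ideal is_ideal, of j] by auto
qed simp

lemma ideal_pow_subset: "1 \<le> i \<Longrightarrow> ideal_pow R I i \<subseteq> I"
  using ideal_pow_antimono[of 1 i] ideal_pow_1 by simp

text \<open>Powers are built by multiplying by \<open>I\<close> on the right. Without commutativity
  the left version needs associativity of the ideal product; it serves to show that \<open>I\<close>
  annihilates \<open>I^k/I^(k+1)\<close> from the left too.\<close>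

lemma ideal_pow_Suc': "ideal_pow R I (Suc i) = ideal_prod R I (ideal_pow R I i)"
proof (induction i)
  case 0
  then show ?case using ideal_pow_1 ideal_prod_one[OF is_ideal] by simp
next
  case (Suc i)
  have "ideal_pow R I (Suc (Suc i)) = ideal_prod R (ideal_prod R I (ideal_pow R I i)) I"
    by (subst ideal_pow_Suc) (simp only: Suc)
  also have "\<dots> = ideal_prod R I (ideal_pow R I (Suc i))"
    by (simp add: ideal_prod_assoc ideal_pow_ideal is_ideal)
  finally show ?case .
qed

lemma ideal_pow_mult_r: "j \<in> ideal_pow R I i \<Longrightarrow> a \<in> I \<Longrightarrow> j \<otimes> a \<in> ideal_pow R I (Suc i)"
  unfolding ideal_pow_Suc by (rule ideal_prod.prod)

lemma ideal_pow_mult_l: "j \<in> ideal_pow R I i \<Longrightarrow> a \<in> I \<Longrightarrow> a \<otimes> j \<in> ideal_pow R I (Suc i)"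
  unfolding ideal_pow_Suc' by (rule ideal_prod.prod)

section \<open>Cosets and the transition maps of the inverse system\<close>

lemma coset_eq_iff:
  "a \<in> carrier R \<Longrightarrow> b \<in> carrier R \<Longrightarrow> I +> a = I +> b \<longleftrightarrow> a \<ominus> b \<in> I"
  using quotient_eq_iff_same_a_r_cos[OF is_ideal] by blast

lemma quot_proj_coset:
  assumes "J \<subseteq> I" "ideal J R" "r \<in> carrier R"
  shows "quot_proj R I (J +> r) = I +> r"
proof -
  interpret J: ideal J R by fact
  show ?thesis
  proof
    show "quot_proj R I (J +> r) \<subseteq> I +> r"
    proof
      fix z assume "z \<in> quot_proj R I (J +> r)"
      then obtain a b where ab: "a \<in> I" "b \<in> J" "z = a \<oplus> (b \<oplus> r)"
        by (auto simp: quot_proj_def set_add_def' a_r_coset_def')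
      then have "z = (a \<oplus> b) \<oplus> r" using assms(3) by (simp add: a_assoc)
      moreover have "a \<oplus> b \<in> I" using ab assms(1) by auto
      ultimately show "z \<in> I +> r" unfolding a_r_coset_def' by blast
    qed
    show "I +> r \<subseteq> quot_proj R I (J +> r)"
    proof
      fix z assume "z \<in> I +> r"
      then obtain a where a: "a \<in> I" "z = a \<oplus> r" by (auto simp: a_r_coset_def')
      then have "z = a \<oplus> (\<zero> \<oplus> r)" using assms(3) by simp
      then show "z \<in> quot_proj R I (J +> r)"
        using a(1) J.zero_closed unfolding quot_proj_def set_add_def' a_r_coset_def' by blast
    qed
  qed
qed

end

section \<open>Complete rings\<close>

locale adic_ring = ideal +
  assumes complete: "adically_complete R I"
begin

lemma adic_bij: "bij_betw (adic_map R I) (carrier R) (carrier (adic_limit R I))"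
  using complete by (simp add: adically_complete_def ring_iso_def)

text \<open>This is injectivity of \<open>adic_map\<close>: \<open>r\<close> and
  \<open>\<zero>\<close> have the same image.\<close>

lemma adic_separated:
  assumes r: "r \<in> carrier R" and "\<And>i. 1 \<le> i \<Longrightarrow> r \<in> ideal_pow R I i"
  shows "r = \<zero>"
proof -
  have "ideal_pow R I i +> r = ideal_pow R I i +> \<zero>" if "1 \<le> i" for i
    using ideal.coset_eq_iff[OF ideal_pow_ideal r zero_closed] assms that
    by (simp add: minus_eq)
  then have "adic_map R I r = adic_map R I \<zero>"
    by (auto simp: adic_map_def intro!: restrict_ext)
  then show ?thesis
    using bij_betw_imp_inj_on[OF adic_bij] r by (auto dest: inj_onD)
qed

text \<open>This is surjectivity of \<open>adic_map\<close>: the cosets of the \<open>s i\<close>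
  modulo \<open>I^i\<close> form a compatible family, and any preimage of it is a limit.\<close>

lemma adic_limit_exists:
  assumes s: "\<And>i. s i \<in> carrier R"
    and Cauchy: "\<And>i. 1 \<le> i \<Longrightarrow> s (Suc i) \<ominus> s i \<in> ideal_pow R I i"
  obtains r where "r \<in> carrier R" "\<And>i. 1 \<le> i \<Longrightarrow> r \<ominus> s i \<in> ideal_pow R I i"
proof -
  let ?P = "ideal_pow R I"
  have diff: "s j \<ominus> s i \<in> ?P i" if "1 \<le> i" "i \<le> j" for i j
    using that(2)
  proof (induction rule: dec_induct)
    case base
    interpret Pi: ideal "?P i" R by (rule ideal_pow_ideal)
    show ?case using s by (simp add: minus_eq r_neg Pi.zero_closed)
  next
    case (step j)
    interpret Pi: ideal "?P i" R by (rule ideal_pow_ideal)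
    have "s (Suc j) \<ominus> s j \<in> ?P i"
      using Cauchy[of j] ideal_pow_antimono[of i j] step that by auto
    moreover have "s (Suc j) \<ominus> s i = (s (Suc j) \<ominus> s j) \<oplus> (s j \<ominus> s i)"
      using s[of i] s[of j] s[of "Suc j"] by algebra
    ultimately show ?case using step by simp
  qed
  define f where "f = (\<lambda>i\<in>{1..}. ?P i +> s i)"
  have "quot_proj R (?P i) (f j) = f i" if "1 \<le> i" "i \<le> j" for i j
    using that diff[OF that] ideal.quot_proj_coset[OF ideal_pow_ideal ideal_pow_antimono[OF that(2)] ideal_pow_ideal s]
      ideal.coset_eq_iff[OF ideal_pow_ideal s s]
    by (simp add: f_def)
  moreover have "?P i +> s i \<in> carrier (R Quot ?P i)" for i
    using s by (auto simp: FactRing_simps)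
  ultimately have "f \<in> carrier (adic_limit R I)"
    by (auto simp: adic_limit_def f_def)
  then obtain r where r: "r \<in> carrier R" "adic_map R I r = f"
    using bij_betw_imp_surj_on[OF adic_bij] by (metis imageE)
  have "r \<ominus> s i \<in> ?P i" if "1 \<le> i" for i
  proof -
    have "?P i +> r = ?P i +> s i"
      using fun_cong[OF r(2), of i] that by (simp add: adic_map_def f_def)
    then show ?thesis using ideal.coset_eq_iff[OF ideal_pow_ideal r(1) s] by simp
  qed
  with r that show ?thesis by blast
qed

text \<open>The inverse is the limit \<open>r\<close> of the geometric partial sums. Both
  \<open>(1 - c) r - 1\<close> and \<open>r (1 - c) - 1\<close> lie in every \<open>I^i\<close>,
  hence vanish by separatedness.\<close>

lemma one_minus_unit:
  assumes c: "c \<in> I"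
  shows "\<one> \<ominus> c \<in> Units R"
proof -
  have cc: "c \<in> carrier R" using c by simp
  have cpow: "c [^] i \<in> ideal_pow R I i" for i :: nat
    by (induction i) (use c ideal_pow_mult_r in auto)
  \<comment> \<open>\<open>s i\<close> is the sum of \<open>c^j\<close> over \<open>j < i\<close>,
    so consecutive terms differ by \<open>c^i\<close>, an element of \<open>I^i\<close>.\<close>
  define s where "s = rec_nat \<zero> (\<lambda>i v. v \<oplus> c [^] (i::nat))"
  have s_simps: "s 0 = \<zero>" "s (Suc i) = s i \<oplus> c [^] i" for i by (simp_all add: s_def)
  have s: "s i \<in> carrier R" for i by (induction i) (auto simp: s_simps cc)
  have "s (Suc i) \<ominus> s i = c [^] i" for i
  proof -
    have "c [^] i \<in> carrier R" using cc by simp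
    then show ?thesis using s[of i] unfolding s_simps by algebra
  qed
  then obtain r where r: "r \<in> carrier R" "\<And>i. 1 \<le> i \<Longrightarrow> r \<ominus> s i \<in> ideal_pow R I i"
    using adic_limit_exists[of s] s cpow by (metis (full_types))
  have l: "(\<one> \<ominus> c) \<otimes> s i = \<one> \<ominus> c [^] i" for i
  proof (induction i)
    case 0 show ?case using cc by (simp add: s_simps minus_eq r_neg)
  next
    case (Suc i)
    have 1: "c [^] i \<in> carrier R" "c [^] Suc i = c \<otimes> c [^] i" using cc by (auto simp only: nat_pow_Suc2 nat_pow_closed)
    have "(\<one> \<ominus> c) \<otimes> s (Suc i) = (\<one> \<ominus> c) \<otimes> s i \<oplus> (\<one> \<ominus> c) \<otimes> c [^] i"
      using 1(1) cc s[of i] unfolding s_simps by algebra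
    also have "\<dots> = \<one> \<ominus> c [^] Suc i" unfolding Suc 1(2) using 1(1) cc by algebra
    finally show ?case .
  qed
  have rr: "s i \<otimes> (\<one> \<ominus> c) = \<one> \<ominus> c [^] i" for i
  proof (induction i)
    case 0 show ?case using cc by (simp add: s_simps minus_eq r_neg)
  next
    case (Suc i)
    have 1: "c [^] i \<in> carrier R" "c [^] Suc i = c [^] i \<otimes> c" using cc by auto
    have "s (Suc i) \<otimes> (\<one> \<ominus> c) = s i \<otimes> (\<one> \<ominus> c) \<oplus> c [^] i \<otimes> (\<one> \<ominus> c)"
      using 1(1) cc s[of i] unfolding s_simps by algebra
    also have "\<dots> = \<one> \<ominus> c [^] Suc i" unfolding Suc 1(2) using 1(1) cc
      by (simp add: minus_eq r_distr r_minus a_assoc r_neg1)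
    finally show ?case .
  qed
  have oc: "\<one> \<ominus> c \<in> carrier R" using cc by simp
  have "(\<one> \<ominus> c) \<otimes> r \<ominus> \<one> \<in> ideal_pow R I i" if "1 \<le> i" for i
  proof -
    interpret Pi: ideal "ideal_pow R I i" R by (rule ideal_pow_ideal)
    have "(\<one> \<ominus> c) \<otimes> r \<ominus> \<one> = (\<one> \<ominus> c) \<otimes> (r \<ominus> s i) \<oplus> ((\<one> \<ominus> c) \<otimes> s i \<ominus> \<one>)"
      using cc r(1) s[of i] by algebra
    also have "(\<one> \<ominus> c) \<otimes> s i \<ominus> \<one> = \<ominus> (c [^] i)"
      unfolding l using nat_pow_closed[OF cc, of i] by algebra
    finally show ?thesis using r(2)[OF that] cpow oc by (simp add: Pi.I_l_closed)
  qed
  then have "(\<one> \<ominus> c) \<otimes> r \<ominus> \<one> = \<zero>" using adic_separated oc r(1) by simp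
  then have "(\<one> \<ominus> c) \<otimes> r = \<one>" using oc r(1) by simp
  moreover have "r \<otimes> (\<one> \<ominus> c) \<ominus> \<one> \<in> ideal_pow R I i" if "1 \<le> i" for i
  proof -
    interpret Pi: ideal "ideal_pow R I i" R by (rule ideal_pow_ideal)
    have "r \<otimes> (\<one> \<ominus> c) \<ominus> \<one> = (r \<ominus> s i) \<otimes> (\<one> \<ominus> c) \<oplus> (s i \<otimes> (\<one> \<ominus> c) \<ominus> \<one>)"
      using cc r(1) s[of i] by algebra
    also have "s i \<otimes> (\<one> \<ominus> c) \<ominus> \<one> = \<ominus> (c [^] i)"
      unfolding rr using nat_pow_closed[OF cc, of i] by algebra
    finally show ?thesis using r(2)[OF that] cpow oc by (simp add: Pi.I_r_closed)
  qed
  then have "r \<otimes> (\<one> \<ominus> c) \<ominus> \<one> = \<zero>" using adic_separated oc r(1) by simp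
  then have "r \<otimes> (\<one> \<ominus> c) = \<one>" using oc r(1) by simp
  ultimately show ?thesis using oc r(1) by (auto simp: Units_def)
qed

text \<open>Both \<open>w y\<close> and \<open>y w\<close> are units by
  \<open>one_minus_unit\<close>. Thus \<open>y\<close> has a left and a right inverse, and these
  coincide.\<close>

lemma unit_lift:
  assumes y: "y \<in> carrier R" and w: "w \<in> carrier R"
    and "w \<otimes> y \<ominus> \<one> \<in> I" "y \<otimes> w \<ominus> \<one> \<in> I"
  shows "y \<in> Units R"
proof -
  have u: "z \<in> Units R" if "z \<in> carrier R" "z \<ominus> \<one> \<in> I" for z
  proof -
    have "z = \<one> \<ominus> \<ominus> (z \<ominus> \<one>)" using that(1) by algebra
    then show ?thesis using one_minus_unit[of "\<ominus> (z \<ominus> \<one>)"] that by simp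
  qed
  have U: "w \<otimes> y \<in> Units R" "y \<otimes> w \<in> Units R" using u assms by auto
  have 1: "inv (w \<otimes> y) \<otimes> w \<otimes> y = \<one>" using U(1) y w by (simp add: m_assoc)
  have 2: "y \<otimes> (w \<otimes> inv (y \<otimes> w)) = \<one>" using U(2) y w by (simp flip: m_assoc)
  have "inv (w \<otimes> y) \<otimes> w = w \<otimes> inv (y \<otimes> w)"
    using inv_unique[OF 1 2] U y w by simp
  moreover have "inv (w \<otimes> y) \<otimes> w \<in> carrier R" using U(1) w by simp
  ultimately show ?thesis using 1 2 y unfolding Units_def by fastforce
qed

text \<open>If a maximal left ideal \<open>M\<close> did not contain \<open>I\<close>, then
  \<open>M + I\<close> would be the whole ring, so \<open>1 = m + c\<close> with \<open>m\<close> in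
  \<open>M\<close> and \<open>c\<close> in \<open>I\<close>; but \<open>m = 1 - c\<close> is a
  unit.\<close>

lemma subset_jacobson_radical: "I \<subseteq> jacobson_radical R"
proof -
  have "I \<subseteq> M" if M: "maximal_left_ideal R M" for M
  proof (rule ccontr)
    interpret M: additive_subgroup M R
      using M by (simp add: maximal_left_ideal_def left_ideal_def)
    have Mlc: "r \<otimes> a \<in> M" if "r \<in> carrier R" "a \<in> M" for r a
      using M that by (simp add: maximal_left_ideal_def left_ideal_def)
    assume nsub: "\<not> I \<subseteq> M"
    have "additive_subgroup (M <+>\<^bsub>R\<^esub> I) R"
      by (rule add_additive_subgroups) unfold_locales
    moreover have "r \<otimes> a \<in> M <+>\<^bsub>R\<^esub> I" if "r \<in> carrier R" "a \<in> M <+>\<^bsub>R\<^esub> I" for r a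
      using that Mlc I_l_closed unfolding set_add_def' by (auto simp: r_distr) metis
    ultimately have "left_ideal R (M <+>\<^bsub>R\<^esub> I)" by (simp add: left_ideal_def)
    moreover have "M \<subseteq> M <+>\<^bsub>R\<^esub> I"
    proof
      fix m assume "m \<in> M"
      then have "m \<oplus> \<zero> \<in> M <+>\<^bsub>R\<^esub> I"
        using additive_subgroup.zero_closed[OF is_additive_subgroup] unfolding set_add_def' by blast
      then show "m \<in> M <+>\<^bsub>R\<^esub> I" using \<open>m \<in> M\<close> by simp
    qed
    moreover have "I \<subseteq> M <+>\<^bsub>R\<^esub> I"
    proof
      fix m assume "m \<in> I"
      then have "\<zero> \<oplus> m \<in> M <+>\<^bsub>R\<^esub> I"
        using M.zero_closed unfolding set_add_def' by blast
      then show "m \<in> M <+>\<^bsub>R\<^esub> I" using \<open>m \<in> I\<close> by simp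
    qed
    ultimately have "M <+>\<^bsub>R\<^esub> I = carrier R"
      using M nsub by (auto simp: maximal_left_ideal_def)
    then obtain m c where mc: "m \<in> M" "c \<in> I" "\<one> = m \<oplus> c"
      using one_closed unfolding set_add_def' by blast
    have "m = \<one> \<ominus> c" unfolding mc(3) using mc by (simp add: minus_eq a_assoc r_neg)
    then have "m \<in> Units R" using one_minus_unit[OF mc(2)] by (simp only:)
    then have "\<one> \<in> M" using Mlc[of "inv m" m] mc(1) by simp
    then have "M = carrier R" using Mlc[of _ \<one>] M.a_subset by auto
    then show False using M by (simp add: maximal_left_ideal_def)
  qed
  then show ?thesis using a_subset by (auto simp: jacobson_radical_def)
qed

end

section \<open>Successive approximation of the idempotent\<close>

text \<open>\<open>lift_commuting_idempotent\<close> is applied in \<open>R/I^(k+1)\<close> to the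
  images of \<open>I^k\<close> and \<open>I\<close>, and a representative of the idempotent found
  there is pulled back to \<open>R\<close>.\<close>

lemma (in ideal) approximation_step:
  assumes k: "1 \<le> k"
    and x: "x \<in> carrier R" and w: "w \<in> carrier R" and e: "e \<in> carrier R"
    and idem: "e \<otimes> e \<ominus> e \<in> ideal_pow R I k" and comm: "x \<otimes> e \<ominus> e \<otimes> x \<in> ideal_pow R I k"
    and we: "w \<otimes> e \<ominus> e \<otimes> w \<in> I"
    and wx: "w \<otimes> (x \<ominus> e) \<ominus> \<one> \<in> I" and xw: "(x \<ominus> e) \<otimes> w \<ominus> \<one> \<in> I"
    and nil: "(e \<otimes> x \<otimes> e) [^] (n::nat) \<in> I"
  shows "\<exists>e'\<in>carrier R. e' \<ominus> e \<in> ideal_pow R I k \<and>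
    e' \<otimes> e' \<ominus> e' \<in> ideal_pow R I (Suc k) \<and> x \<otimes> e' \<ominus> e' \<otimes> x \<in> ideal_pow R I (Suc k)"
proof -
  define J where "J = ideal_pow R I k"
  define N where "N = ideal_pow R I (Suc k)"
  interpret J: ideal J R unfolding J_def by (rule ideal_pow_ideal)
  interpret N: ideal N R unfolding N_def by (rule ideal_pow_ideal)
  have NJ: "N \<subseteq> J" unfolding N_def J_def by (rule ideal_pow_antimono) simp
  have JI: "J \<subseteq> I" unfolding J_def using k by (rule ideal_pow_subset)
  let ?S = "R Quot N"
  define h where "h = (\<lambda>r. N +> r)"
  interpret h: ring_hom_ring R ?S h
    using N.rcos_ring_hom_ring unfolding h_def .
  have S_carr: "carrier ?S = h ` carrier R"
    by (auto simp: FactRing_simps h_def)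
  have h_eq: "h a = h b \<longleftrightarrow> a \<ominus> b \<in> N" if "a \<in> carrier R" "b \<in> carrier R" for a b
    using that unfolding h_def by (rule N.coset_eq_iff)
  have h_minus: "h (a \<ominus> b) = h a \<ominus>\<^bsub>?S\<^esub> h b" if "a \<in> carrier R" "b \<in> carrier R" for a b
    using that by (simp add: a_minus_def)
  have h_pow: "h (a [^] (m::nat)) = h a [^]\<^bsub>?S\<^esub> m" if "a \<in> carrier R" for a m
    using that by (induction m) auto
  have h_zero: "h a = \<zero>\<^bsub>?S\<^esub>" if "a \<in> N" for a
    using that N.a_rcos_const by (simp add: h_def FactRing_def)
  have imgI: "h a \<in> h ` A" if "a \<in> A" for a A using that by blast
  have ideals: "ideal (h ` J) ?S" "ideal (h ` I) ?S"
    unfolding h_def using ring_ideal_imp_quot_ideal[OF N.is_ideal] J.is_ideal is_ideal by auto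
  have sub: "h ` J \<subseteq> h ` I" using JI by blast
  have annihil: "i \<otimes>\<^bsub>?S\<^esub> j = \<zero>\<^bsub>?S\<^esub>" "j \<otimes>\<^bsub>?S\<^esub> i = \<zero>\<^bsub>?S\<^esub>" if ij: "i \<in> h ` I" "j \<in> h ` J" for i j
  proof -
    obtain a where a: "a \<in> I" "i = h a" using ij(1) by (elim imageE)
    obtain b where b: "b \<in> J" "j = h b" using ij(2) by (elim imageE)
    note ab = a(1) b(1) a(2) b(2)
    have bk: "b \<in> ideal_pow R I k" using ab(2) by (simp add: J_def)
    have "a \<otimes> b \<in> N" "b \<otimes> a \<in> N"
      unfolding N_def using bk ab(1) by (rule ideal_pow_mult_l ideal_pow_mult_r)+
    then have "h (a \<otimes> b) = \<zero>\<^bsub>?S\<^esub>" "h (b \<otimes> a) = \<zero>\<^bsub>?S\<^esub>" by (simp_all only: h_zero)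
    then show "i \<otimes>\<^bsub>?S\<^esub> j = \<zero>\<^bsub>?S\<^esub>" "j \<otimes>\<^bsub>?S\<^esub> i = \<zero>\<^bsub>?S\<^esub>"
      using ab by simp_all
  qed
  have mod_J: "h e \<otimes>\<^bsub>?S\<^esub> h e \<ominus>\<^bsub>?S\<^esub> h e \<in> h ` J"
    "h x \<otimes>\<^bsub>?S\<^esub> h e \<ominus>\<^bsub>?S\<^esub> h e \<otimes>\<^bsub>?S\<^esub> h x \<in> h ` J"
    using imgI[OF idem] imgI[OF comm] x e by (simp_all add: h_minus J_def)
  have mod_I: "h w \<otimes>\<^bsub>?S\<^esub> h e \<ominus>\<^bsub>?S\<^esub> h e \<otimes>\<^bsub>?S\<^esub> h w \<in> h ` I"
    "h w \<otimes>\<^bsub>?S\<^esub> (h x \<ominus>\<^bsub>?S\<^esub> h e) \<ominus>\<^bsub>?S\<^esub> \<one>\<^bsub>?S\<^esub> \<in> h ` I"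
    "(h x \<ominus>\<^bsub>?S\<^esub> h e) \<otimes>\<^bsub>?S\<^esub> h w \<ominus>\<^bsub>?S\<^esub> \<one>\<^bsub>?S\<^esub> \<in> h ` I"
    "(h e \<otimes>\<^bsub>?S\<^esub> h x \<otimes>\<^bsub>?S\<^esub> h e) [^]\<^bsub>?S\<^esub> n \<in> h ` I"
    using imgI[OF we] imgI[OF wx] imgI[OF xw] imgI[OF nil] x e w
    by (simp_all add: h_minus h_pow)
  have "\<exists>E\<in>carrier ?S. E \<ominus>\<^bsub>?S\<^esub> h e \<in> h ` J \<and>
      E \<otimes>\<^bsub>?S\<^esub> E = E \<and> h x \<otimes>\<^bsub>?S\<^esub> E = E \<otimes>\<^bsub>?S\<^esub> h x"
    by (rule ring.lift_commuting_idempotent[OF N.quotient_is_ring ideals sub annihil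
        h.hom_closed[OF x] h.hom_closed[OF w] h.hom_closed[OF e] mod_J mod_I])
  then obtain E where E: "E \<in> carrier ?S" "E \<ominus>\<^bsub>?S\<^esub> h e \<in> h ` J"
    "E \<otimes>\<^bsub>?S\<^esub> E = E" "h x \<otimes>\<^bsub>?S\<^esub> E = E \<otimes>\<^bsub>?S\<^esub> h x"
    by blast
  obtain e' where e': "e' \<in> carrier R" "E = h e'" using E(1) S_carr by blast
  have "h (e' \<ominus> e) \<in> h ` J" using E(2) e' e by (simp add: h_minus)
  then obtain j where j: "j \<in> J" "h (e' \<ominus> e) = h j" by blast
  \<comment> \<open>Equality of images only puts this difference in \<open>N\<close>; the inclusion
    of \<open>N\<close> in \<open>J\<close> gives the congruence in \<open>R\<close> itself.\<close>
  then have "(e' \<ominus> e) \<ominus> j \<in> J" using h_eq[of "e' \<ominus> e" j] e' e NJ by auto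
  then have "((e' \<ominus> e) \<ominus> j) \<oplus> j \<in> J" using j by simp
  moreover have "((e' \<ominus> e) \<ominus> j) \<oplus> j = e' \<ominus> e" using e' e J.a_Hcarr[OF j(1)] by algebra
  ultimately have "e' \<ominus> e \<in> J" by simp
  moreover have "e' \<otimes> e' \<ominus> e' \<in> N" using E(3) e' by (simp flip: h_eq)
  moreover have "x \<otimes> e' \<ominus> e' \<otimes> x \<in> N" using E(4) e' x by (simp flip: h_eq)
  ultimately show ?thesis using e'(1) unfolding J_def N_def by blast
qed

lemma (in adic_ring) strongly_pi_clean_lift:
  assumes x: "x \<in> carrier R" and reg: "strongly_pi_regular (R Quot I) (I +> x) n"
  shows "strongly_pi_clean R I x n"
proof -
  let ?Q = "R Quot I"
  let ?P = "ideal_pow R I"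
  define h where "h = (\<lambda>r. I +> r)"
  interpret h: ring_hom_ring R ?Q h
    using rcos_ring_hom_ring unfolding h_def .
  have Q_carr: "carrier ?Q = h ` carrier R"
    by (auto simp: FactRing_simps h_def)
  have h_eq: "h a = h b \<longleftrightarrow> a \<ominus> b \<in> I" if "a \<in> carrier R" "b \<in> carrier R" for a b
    using that unfolding h_def by (rule coset_eq_iff)
  have h_minus: "h (a \<ominus> b) = h a \<ominus>\<^bsub>?Q\<^esub> h b" if "a \<in> carrier R" "b \<in> carrier R" for a b
    using that by (simp add: a_minus_def)
  have h_pow: "h (a [^] (m::nat)) = h a [^]\<^bsub>?Q\<^esub> m" if "a \<in> carrier R" for a m
    using that by (induction m) auto
  have h_zero: "a \<in> I" if "a \<in> carrier R" "h a = \<zero>\<^bsub>?Q\<^esub>" for a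
    using that a_rcos_self[of a] by (simp add: h_def FactRing_def)

  obtain E where E: "E \<in> carrier ?Q" "E \<otimes>\<^bsub>?Q\<^esub> E = E" "E \<otimes>\<^bsub>?Q\<^esub> h x = h x \<otimes>\<^bsub>?Q\<^esub> E"
    "h x \<ominus>\<^bsub>?Q\<^esub> E \<in> Units ?Q" "(E \<otimes>\<^bsub>?Q\<^esub> h x \<otimes>\<^bsub>?Q\<^esub> E) [^]\<^bsub>?Q\<^esub> n = \<zero>\<^bsub>?Q\<^esub>"
    using reg unfolding strongly_pi_regular_def strongly_pi_clean_def e_strongly_pi_clean_def
      e_strongly_clean_def h_def by blast
  obtain e0 where e0: "e0 \<in> carrier R" "E = h e0" using E(1) Q_carr by blast
  define W where "W = inv\<^bsub>?Q\<^esub> (h x \<ominus>\<^bsub>?Q\<^esub> E)"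
  have W: "W \<in> carrier ?Q" "W \<otimes>\<^bsub>?Q\<^esub> (h x \<ominus>\<^bsub>?Q\<^esub> E) = \<one>\<^bsub>?Q\<^esub>"
    "(h x \<ominus>\<^bsub>?Q\<^esub> E) \<otimes>\<^bsub>?Q\<^esub> W = \<one>\<^bsub>?Q\<^esub>"
    using E(4) by (auto simp: W_def)
  define Y where "Y = h x \<ominus>\<^bsub>?Q\<^esub> E"
  have Y: "Y \<in> carrier ?Q" using E(1) x by (simp add: Y_def)
  have "Y \<otimes>\<^bsub>?Q\<^esub> E = h x \<otimes>\<^bsub>?Q\<^esub> E \<ominus>\<^bsub>?Q\<^esub> E \<otimes>\<^bsub>?Q\<^esub> E"
    using E(1) h.hom_closed[OF x] unfolding Y_def by (simp add: h.S.minus_eq h.S.l_distr h.S.l_minus)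
  also have "\<dots> = E \<otimes>\<^bsub>?Q\<^esub> Y"
    using E(1) h.hom_closed[OF x] E(3) unfolding Y_def by (simp add: h.S.minus_eq h.S.r_distr h.S.r_minus)
  finally have YE: "Y \<otimes>\<^bsub>?Q\<^esub> E = E \<otimes>\<^bsub>?Q\<^esub> Y" .
  \<comment> \<open>The inverse of \<open>Y\<close> commutes with whatever commutes with
    \<open>Y\<close>: \<open>W E = W E Y W = W Y E W = E W\<close>.\<close>
  have "W \<otimes>\<^bsub>?Q\<^esub> E = W \<otimes>\<^bsub>?Q\<^esub> (E \<otimes>\<^bsub>?Q\<^esub> (Y \<otimes>\<^bsub>?Q\<^esub> W))"
    using W(3) E(1) by (simp add: Y_def)
  also have "\<dots> = W \<otimes>\<^bsub>?Q\<^esub> (E \<otimes>\<^bsub>?Q\<^esub> Y \<otimes>\<^bsub>?Q\<^esub> W)"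
    using W(1) E(1) Y by (simp add: h.S.m_assoc)
  also have "\<dots> = (W \<otimes>\<^bsub>?Q\<^esub> Y) \<otimes>\<^bsub>?Q\<^esub> E \<otimes>\<^bsub>?Q\<^esub> W"
    unfolding YE[symmetric] using W(1) E(1) Y by (simp add: h.S.m_assoc)
  also have "\<dots> = E \<otimes>\<^bsub>?Q\<^esub> W"
    using W(1,2) E(1) by (simp add: Y_def)
  finally have WE: "W \<otimes>\<^bsub>?Q\<^esub> E = E \<otimes>\<^bsub>?Q\<^esub> W" .
  obtain w where w: "w \<in> carrier R" "W = h w" using W(1) Q_carr by blast

  \<comment> \<open>These conditions depend only on \<open>e\<close> modulo \<open>I\<close>. One
    lift \<open>w\<close> of the inverse therefore serves at every stage and for the limit.\<close>
  have mod_I: "w \<otimes> e \<ominus> e \<otimes> w \<in> I" "w \<otimes> (x \<ominus> e) \<ominus> \<one> \<in> I" "(x \<ominus> e) \<otimes> w \<ominus> \<one> \<in> I"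
    "(e \<otimes> x \<otimes> e) [^] n \<in> I" if e: "e \<in> carrier R" "e \<ominus> e0 \<in> I" for e
  proof -
    have he: "h e = E" using e e0 h_eq by simp
    show "w \<otimes> e \<ominus> e \<otimes> w \<in> I" "w \<otimes> (x \<ominus> e) \<ominus> \<one> \<in> I" "(x \<ominus> e) \<otimes> w \<ominus> \<one> \<in> I"
      using WE W(2,3) e(1) w x by (simp_all add: h_minus he flip: h_eq)
    show "(e \<otimes> x \<otimes> e) [^] n \<in> I"
      using E(5) e(1) x by (intro h_zero) (simp_all add: h_pow he)
  qed

  \<comment> \<open>The index is shifted: \<open>good k\<close> speaks of \<open>I^(k+1)\<close>, so
    \<open>e0\<close> starts the sequence at \<open>k = 0\<close> and the exponent passed to
    \<open>approximation_step\<close> is always at least 1.\<close>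
  define good where "good = (\<lambda>k e. e \<in> carrier R \<and> e \<ominus> e0 \<in> I \<and>
    e \<otimes> e \<ominus> e \<in> ?P (Suc k) \<and> x \<otimes> e \<ominus> e \<otimes> x \<in> ?P (Suc k))"
  have "\<exists>f. \<forall>k. good k (f k) \<and> f (Suc k) \<ominus> f k \<in> ?P (Suc k)"
  proof (rule dependent_nat_choice)
    have "e0 \<ominus> e0 \<in> I" "e0 \<otimes> e0 \<ominus> e0 \<in> I" "x \<otimes> e0 \<ominus> e0 \<otimes> x \<in> I"
      using E e0 x by (simp_all flip: h_eq)
    then show "\<exists>e. good 0 e"
      using e0(1) unfolding good_def ideal_pow_1 by blast
  next
    fix e k assume e: "good k e"
    then obtain e' where e': "e' \<in> carrier R" "e' \<ominus> e \<in> ?P (Suc k)"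
      "e' \<otimes> e' \<ominus> e' \<in> ?P (Suc (Suc k))" "x \<otimes> e' \<ominus> e' \<otimes> x \<in> ?P (Suc (Suc k))"
      using approximation_step[of "Suc k" x w e n] x w(1) mod_I[of e] unfolding good_def by auto
    have "e' \<ominus> e \<in> I" using e'(2) ideal_pow_subset[of "Suc k"] by auto
    then have "(e' \<ominus> e) \<oplus> (e \<ominus> e0) \<in> I" using e by (simp add: good_def)
    moreover have "(e' \<ominus> e) \<oplus> (e \<ominus> e0) = e' \<ominus> e0"
      using e e'(1) e0(1) unfolding good_def by algebra
    ultimately show "\<exists>e'. good (Suc k) e' \<and> e' \<ominus> e \<in> ?P (Suc k)"
      using e' unfolding good_def by auto
  qed
  then obtain f where f: "\<And>k. good k (f k)" "\<And>k. f (Suc k) \<ominus> f k \<in> ?P (Suc k)" by blast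
  have fc: "f k \<in> carrier R" for k using f(1) by (simp add: good_def)
  have "f (Suc k) \<ominus> f k \<in> ?P k" for k
    using f(2)[of k] ideal_pow_antimono[of k "Suc k"] by auto
  then obtain e where e: "e \<in> carrier R" "\<And>i. 1 \<le> i \<Longrightarrow> e \<ominus> f i \<in> ?P i"
    using adic_limit_exists[of f] fc by (metis (full_types))
  \<comment> \<open>Since \<open>e\<close> agrees with \<open>f i\<close> modulo \<open>I^i\<close>,
    it inherits the congruences of \<open>f i\<close>; as \<open>i\<close> is arbitrary,
    separatedness turns them into equations.\<close>
  have approx: "e \<otimes> e \<ominus> e \<in> ?P i" "x \<otimes> e \<ominus> e \<otimes> x \<in> ?P i" if i: "1 \<le> i" for i
  proof -
    interpret Pi: ideal "?P i" R by (rule ideal_pow_ideal)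
    have fi: "f i \<otimes> f i \<ominus> f i \<in> ?P i" "x \<otimes> f i \<ominus> f i \<otimes> x \<in> ?P i"
      using f(1)[of i] ideal_pow_antimono[of i "Suc i"] unfolding good_def by auto
    have "e \<otimes> e \<ominus> e = (f i \<otimes> f i \<ominus> f i) \<oplus> (e \<ominus> f i) \<otimes> e \<oplus> f i \<otimes> (e \<ominus> f i) \<oplus> \<ominus> (e \<ominus> f i)"
      using e(1) fc[of i] by algebra
    then show "e \<otimes> e \<ominus> e \<in> ?P i"
      using fi(1) e(1) e(2)[OF i] fc by (simp add: Pi.I_l_closed Pi.I_r_closed)
    have "x \<otimes> e \<ominus> e \<otimes> x = (x \<otimes> f i \<ominus> f i \<otimes> x) \<oplus> x \<otimes> (e \<ominus> f i) \<oplus> \<ominus> ((e \<ominus> f i) \<otimes> x)"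
      using e(1) fc[of i] x by algebra
    then show "x \<otimes> e \<ominus> e \<otimes> x \<in> ?P i"
      using fi(2) x e(2)[OF i] by (simp add: Pi.I_l_closed Pi.I_r_closed)
  qed
  have ee: "e \<otimes> e = e"
    using adic_separated[OF _ approx(1)] e(1) by simp
  have xe: "x \<otimes> e = e \<otimes> x"
    using adic_separated[OF _ approx(2)] e(1) x by simp
  \<comment> \<open>Comparing with \<open>f 1\<close> shows that \<open>e\<close> still lifts
    \<open>E\<close>, which makes \<open>mod_I\<close> available for the limit.\<close>
  have "(e \<ominus> f 1) \<oplus> (f 1 \<ominus> e0) \<in> I"
    using e(2)[of 1] f(1)[of 1] ideal_pow_subset[of 1] unfolding good_def by auto
  moreover have "(e \<ominus> f 1) \<oplus> (f 1 \<ominus> e0) = e \<ominus> e0" using e(1) e0(1) fc[of 1] by algebra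
  ultimately have eI: "e \<ominus> e0 \<in> I" by simp
  have "x \<ominus> e \<in> Units R"
    using unit_lift[of "x \<ominus> e" w] mod_I[OF e(1) eI] x e(1) w(1) by simp
  then have "e_strongly_pi_clean R I e x n"
    using e(1) x ee xe mod_I(4)[OF e(1) eI]
    by (simp add: e_strongly_pi_clean_def e_strongly_clean_def)
  then show ?thesis by (auto simp: strongly_pi_clean_def)
qed

theorem mainTheorem1:
  fixes R :: "('a, 'b) ring_scheme" and I :: "'a set"
  assumes "ring R" and "ideal I R" and "adically_complete R I"
  shows "I \<subseteq> jacobson_radical R \<and>
    (\<forall>x\<in>carrier R. \<forall>n::nat. 0 < n \<longrightarrow>
       strongly_pi_regular (R Quot I) (I +>\<^bsub>R\<^esub> x) n \<longrightarrow>
       strongly_pi_clean R I x n \<and> strongly_clean R x)"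
proof -
  interpret adic_ring I R
    using assms by (simp add: adic_ring_def adic_ring_axioms_def)
  show ?thesis
    using subset_jacobson_radical strongly_pi_clean_lift
    unfolding strongly_clean_def strongly_pi_clean_def e_strongly_pi_clean_def by blast
qed

end
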